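(* Let $A$, $\widehat P_0$, and the contraction constant $r<1$ be as in the context. There is $\delta>0$ such that the following holds for every sequence of Newton iterates $\{u_k\}$ as in the context with $\|e_0\|<\delta$. If the correction equation is solved exactly at every step, i.e. $s_k\perp u_k$ and $J_ks_k=-r_k$ for all $k\ge 0$, then for every $k\ge 0$ the matrix $\widehat P_k$ defined by the recursion $$\widehat P_{k+1}=-\frac{s_ks_k^\top}{s_k^\top r_k}+\Big(I-\frac{s_kr_k^\top}{s_k^\top r_k}\Big)\widehat P_k\Big(I-\frac{r_ks_k^\top}{s_k^\top r_k}\Big)$$ is symmetric positive definite, and hence $P_k=(I-u_ku_k^\top)\widehat P_k(I-u_ku_k^\top)$ is symmetric positive definite on the subspace orthogonal to $u_k$.
   Context: $A\in\mathbb{R}^{n\times n}$ is symmetric positive definite with eigenvalues $\lambda_1<\lambda_2<\dots<\lambda_n$ and corresponding unit eigenvectors $v_1,\dots,v_n$. Newton iteration for the smallest eigenpair: $u_0$ is a unit vector; for $k\ge 0$, $\theta_k=u_k^\top A u_k$, $r_k=Au_k-\theta_k u_k$ (residual vector), and $$J_k=(I-u_ku_k^\top)(A-\theta_k I)(I-u_ku_k^\top).$$ The vector $s_k$ is the solution, orthogonal to $u_k$, of the correction equation $J_k s_k=-r_k$, and $u_{k+1}=(u_k+s_k)/\|u_k+s_k\|$. It is assumed that $s_k\neq 0$, so that the recursion for $\widehat P_k$ makes sense. Set $e_k=u_k-v_1$. Standing assumption: convergence holds, i.e. there is a constant $r<1$ with $\|e_{k+1}\|<r\|e_k\|$ for all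 $k\ge0$. The initial preconditioner is $\widehat P_0=(LL^\top)^{-1}$, where $L$ is a nonsingular lower triangular (incomplete Cholesky) factor; thus $\widehat P_0$ is symmetric positive definite. *)

theory Defs
  imports "HOL-Analysis.Analysis"
begin

definition outer :: "real ^ 'n \<Rightarrow> real ^ 'n \<Rightarrow> real ^ 'n ^ 'n" where
  "outer x y = (columnvector x :: real ^ 1 ^ 'n) ** (rowvector y :: real ^ 'n ^ 1)"

definition spd_on :: "(real ^ 'n) set \<Rightarrow> real ^ 'n ^ 'n \<Rightarrow> bool" where
  "spd_on W M \<longleftrightarrow> transpose M = M \<and> (\<forall>x\<in>W. x \<noteq> 0 \<longrightarrow> x \<bullet> (M *v x) > 0)"

abbreviation spd :: "real ^ 'n ^ 'n \<Rightarrow> bool" where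
  "spd M \<equiv> spd_on UNIV M"

definition lower_triangular :: "real ^ ('n :: {finite, linorder}) ^ ('n :: {finite, linorder}) \<Rightarrow> bool" where
  "lower_triangular L \<longleftrightarrow> (\<forall>i j. i < j \<longrightarrow> L $ i $ j = 0)"

definition rayleigh :: "real ^ 'n ^ 'n \<Rightarrow> real ^ 'n \<Rightarrow> real" where
  "rayleigh A u = u \<bullet> (A *v u)"

definition residual :: "real ^ 'n ^ 'n \<Rightarrow> real ^ 'n \<Rightarrow> real ^ 'n" where
  "residual A u = A *v u - rayleigh A u *\<^sub>R u"

definition orth_proj :: "real ^ 'n \<Rightarrow> real ^ 'n ^ 'n" where
  "orth_proj u = mat 1 - outer u u"

definition jacobian :: "real ^ 'n ^ 'n \<Rightarrow> real ^ 'n \<Rightarrow> real ^ 'n ^ 'n" where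
  "jacobian A u = orth_proj u ** (A - rayleigh A u *\<^sub>R mat 1) ** orth_proj u"

definition newton_iterates ::
    "real ^ 'n ^ 'n \<Rightarrow> (nat \<Rightarrow> real ^ 'n) \<Rightarrow> (nat \<Rightarrow> real ^ 'n) \<Rightarrow> bool" where
  "newton_iterates A u s \<longleftrightarrow>
     norm (u 0) = 1 \<and>
     (\<forall>k. orthogonal (s k) (u k) \<and>
          jacobian A (u k) *v s k = - residual A (u k) \<and>
          s k \<noteq> 0 \<and>
          u (Suc k) = (1 / norm (u k + s k)) *\<^sub>R (u k + s k))"

definition precond_update ::
    "real ^ 'n \<Rightarrow> real ^ 'n \<Rightarrow> real ^ 'n ^ 'n \<Rightarrow> real ^ 'n ^ 'n" where
  "precond_update s r P =
     - ((1 / (s \<bullet> r)) *\<^sub>R outer s s) +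
     (mat 1 - (1 / (s \<bullet> r)) *\<^sub>R outer s r) ** P ** (mat 1 - (1 / (s \<bullet> r)) *\<^sub>R outer r s)"

primrec precond_seq ::
    "real ^ 'n ^ 'n \<Rightarrow> (nat \<Rightarrow> real ^ 'n) \<Rightarrow> (nat \<Rightarrow> real ^ 'n) \<Rightarrow> nat \<Rightarrow> real ^ 'n ^ 'n" where
  "precond_seq P0 s r 0 = P0"
| "precond_seq P0 s r (Suc k) = precond_update (s k) (r k) (precond_seq P0 s r k)"

end

theory Submission
  imports Defs
begin

text \<open>
  Since \<open>s\<^sub>k\<close> is orthogonal to \<open>u\<^sub>k\<close>, the correction equation gives
  \<open>- s\<^sub>k \<bullet> r\<^sub>k = s\<^sub>k \<bullet> (A - \<theta>\<^sub>k I) s\<^sub>k\<close>. For \<open>u\<^sub>k\<close> near \<open>v\<^sub>1\<close> the right-hand side is positive: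
  \<open>\<theta>\<^sub>k\<close> is close to \<open>\<lambda>\<^sub>1\<close> and \<open>s\<^sub>k\<close> is almost orthogonal to \<open>v\<^sub>1\<close>, so its Rayleigh quotient is
  close to \<open>\<lambda>\<^sub>2\<close> or larger. With \<open>s\<^sub>k \<bullet> r\<^sub>k < 0\<close> the BFGS-type update is a congruence transform of
  \<open>P\<^sub>k\<close> plus a nonnegative rank-one term which is positive exactly where the congruence may degenerate.
\<close>

section \<open>Algebra of rank-one matrices, transposes and projections\<close>

lemma outer_mult_vec: "outer x y *v z = (y \<bullet> z) *\<^sub>R x"
  by (simp add: vec_eq_iff outer_def columnvector_def rowvector_def matrix_vector_mult_def
      matrix_matrix_mult_def inner_vec_def sum_distrib_left mult_ac)

lemma transpose_outer: "transpose (outer x y) = outer y x"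
  by (simp add: vec_eq_iff outer_def columnvector_def rowvector_def transpose_def
      matrix_matrix_mult_def mult.commute)

lemma transpose_diff: "transpose (M - N) = transpose M - transpose (N :: 'a::ab_group_add ^ 'n ^ 'm)"
  by (simp add: vec_eq_iff transpose_def)

lemma transpose_scaleR: "transpose (c *\<^sub>R M) = c *\<^sub>R transpose (M :: real ^ 'n ^ 'm)"
  by (simp add: vec_eq_iff transpose_def)

lemma uminus_mult_vec: "(- M) *v x = - (M *v (x :: real ^ 'n))"
  by (simp add: vec_eq_iff matrix_vector_mult_def sum_negf)

lemma scaleR_mult_vec: "(c *\<^sub>R M) *v x = c *\<^sub>R (M *v (x :: real ^ 'n))"
  by (simp add: vec_eq_iff matrix_vector_mult_def sum_distrib_left mult_ac)

lemma inner_mult_vec: "x \<bullet> (M *v y) = (transpose M *v x) \<bullet> (y :: real ^ 'n)"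
  by (simp add: dot_lmul_matrix)

lemma transpose_orth_proj: "transpose (orth_proj u) = orth_proj u"
  by (simp add: orth_proj_def transpose_diff transpose_outer transpose_mat)

lemma orth_proj_mult_vec: "orth_proj u *v x = x - (u \<bullet> x) *\<^sub>R u"
  by (simp add: orth_proj_def matrix_vector_mult_diff_rdistrib outer_mult_vec)

section \<open>Positive definiteness of the preconditioners\<close>

text \<open>On vectors orthogonal to \<open>u\<close> the symmetric factor
  \<open>orth_proj u\<close> acts as the identity, so the projected quadratic form agrees there with
  that of \<open>P\<close>.\<close>

lemma spd_on_orth_proj:
  assumes "spd P"
  shows "spd_on {x. orthogonal x u} (orth_proj u ** P ** orth_proj u)"
proof -
  have "x \<bullet> ((orth_proj u ** P ** orth_proj u) *v x) > 0" if "orthogonal x u" "x \<noteq> 0" for x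
  proof -
    have "orth_proj u *v x = x"
      using that(1) by (simp add: orth_proj_mult_vec orthogonal_def inner_commute)
    then have "x \<bullet> ((orth_proj u ** P ** orth_proj u) *v x) = x \<bullet> (P *v x)"
      by (simp add: matrix_vector_mul_assoc[symmetric] inner_mult_vec[of x "orth_proj u"]
          transpose_orth_proj)
    then show ?thesis
      using assms that(2) by (simp add: spd_on_def)
  qed
  then show ?thesis
    using assms
    by (auto simp: spd_on_def matrix_transpose_mul transpose_orth_proj matrix_mul_assoc)
qed

lemma spd_precond_update:
  assumes P: "spd P" and neg: "s \<bullet> r < 0"
  shows "spd (precond_update s r P)"
proof -
  define c where "c = 1 / (s \<bullet> r)"
  have c: "c < 0"
    using neg by (simp add: c_def)
  \<comment> \<open>Since \<open>c * (s \<bullet> r) = 1\<close>, this factor sends \<open>r\<close>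
    to 0, so the congruence by itself is only semidefinite.\<close>
  let ?N = "mat 1 - c *\<^sub>R outer r s"
  have N: "transpose ?N = mat 1 - c *\<^sub>R outer s r"
    by (simp add: transpose_diff transpose_scaleR transpose_outer transpose_mat)
  have upd: "precond_update s r P = - (c *\<^sub>R outer s s) + transpose ?N ** P ** ?N"
    unfolding N by (simp add: precond_update_def c_def)
  have "transpose (precond_update s r P) = precond_update s r P"
    using P unfolding upd
    by (simp add: spd_on_def transpose_diff transpose_scaleR transpose_outer transpose_mat
        matrix_transpose_mul matrix_mul_assoc)
  moreover have "x \<bullet> (precond_update s r P *v x) > 0" if "x \<noteq> 0" for x
  proof -
    let ?y = "?N *v x"
    have y: "?y = x - (c * (s \<bullet> x)) *\<^sub>R r"
      by (simp add: matrix_vector_mult_diff_rdistrib scaleR_mult_vec outer_mult_vec)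
    have "x \<bullet> ((transpose ?N ** P ** ?N) *v x) = ?y \<bullet> (P *v ?y)"
      by (simp add: matrix_vector_mul_assoc[symmetric] inner_mult_vec[of x "transpose ?N"]
          del: transpose_matrix_vector)
    then have eq: "x \<bullet> (precond_update s r P *v x) = - c * (s \<bullet> x)\<^sup>2 + ?y \<bullet> (P *v ?y)"
      unfolding upd matrix_vector_mult_add_rdistrib uminus_mult_vec scaleR_mult_vec inner_add_right
      by (simp add: outer_mult_vec inner_commute[of x s] power2_eq_square)
    show ?thesis
    \<comment> \<open>If \<open>s \<bullet> x = 0\<close>, then \<open>?y = x\<close> and
      \<open>P\<close> gives strict positivity. Otherwise \<open>?y\<close> may vanish, and the
      rank-one term is the strictly positive one.\<close>
    proof (cases "s \<bullet> x = 0")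
      case True
      then show ?thesis
        using eq y P that by (simp add: spd_on_def)
    next
      case False
      then have "- c * (s \<bullet> x)\<^sup>2 > 0"
        using c by (simp add: mult_neg_pos)
      moreover have "?y \<bullet> (P *v ?y) \<ge> 0"
        using P by (cases "?y = 0") (auto simp: spd_on_def less_imp_le)
      ultimately show ?thesis
        using eq by linarith
    qed
  qed
  ultimately show ?thesis
    by (simp add: spd_on_def)
qed

text \<open>With \<open>y\<close> the image of \<open>x\<close> under the inverse,
  \<open>x \<bullet> y\<close> is the squared norm of \<open>transpose L *v y\<close>, which
  vanishes only for \<open>x = 0\<close>.\<close>

lemma spd_matrix_inv_mult_transpose:
  fixes L :: "real ^ 'n ^ 'n"
  assumes "invertible L"
  shows "spd (matrix_inv (L ** transpose L))"
proof -
  let ?M = "L ** transpose L" and ?P = "matrix_inv (L ** transpose L)"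
  have Lt: "invertible (transpose L)"
    using assms by (simp add: transpose_invertible)
  have inv: "invertible ?M"
    using assms Lt by (rule invertible_mult)
  have MP: "?M ** ?P = mat 1"
    using someI_ex[OF inv[unfolded invertible_def]] by (simp add: matrix_inv_def)
  have M: "transpose ?M = ?M"
    by (simp add: matrix_transpose_mul)
  \<comment> \<open>Transposing \<open>MP\<close> makes \<open>transpose ?P\<close> a left inverse
    of \<open>?M\<close>; it must equal the right inverse \<open>?P\<close>, which gives
    symmetry.\<close>
  have "transpose ?P ** ?M = mat 1"
    by (metis M MP matrix_transpose_mul transpose_mat)
  then have "transpose ?P = ?P"
    by (metis MP matrix_mul_assoc matrix_mul_lid matrix_mul_rid)
  moreover have "x \<bullet> (?P *v x) > 0" if "x \<noteq> 0" for x
  proof -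
    let ?y = "?P *v x"
    have x: "x = ?M *v ?y"
      by (simp add: matrix_vector_mul_assoc MP)
    have "x \<bullet> ?y = (transpose L *v ?y) \<bullet> (transpose L *v ?y)"
      by (subst x) (simp add: matrix_vector_mul_assoc[symmetric] inner_mult_vec
          inner_commute[of "L *v _"] del: transpose_matrix_vector)
    moreover have "transpose L *v ?y \<noteq> 0"
    proof
      assume "transpose L *v ?y = 0"
      then have "?M *v ?y = 0"
        by (simp add: matrix_vector_mul_assoc[symmetric] del: transpose_matrix_vector)
      then show False
        using x that by simp
    qed
    ultimately show ?thesis
      by simp
  qed
  ultimately show ?thesis
    by (simp add: spd_on_def)
qed

section \<open>Spectral gap and the shifted quadratic form\<close>

text \<open>Distinct eigenvalues of a symmetric matrix have orthogonal eigenvectors, and as many of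
  these as the dimension form an orthonormal basis.\<close>

lemma eigenbasis_expansion:
  fixes A :: "real ^ 'n ^ 'n" and v :: "'i \<Rightarrow> real ^ 'n"
  assumes sym: "transpose A = A"
    and I: "finite I" "card I = CARD('n)" and lam: "inj_on lam I"
    and eig: "\<And>i. i \<in> I \<Longrightarrow> norm (v i) = 1 \<and> A *v v i = lam i *\<^sub>R v i"
  shows "(\<Sum>i\<in>I. (x \<bullet> v i) *\<^sub>R v i) = x"
proof -
  have orth: "v i \<bullet> v j = 0" if "i \<in> I" "j \<in> I" "i \<noteq> j" for i j
  proof -
    have "v i \<bullet> (A *v v j) = (A *v v i) \<bullet> v j"
      by (metis inner_mult_vec sym)
    then have "(lam i - lam j) * (v i \<bullet> v j) = 0"
      using eig that by (auto simp: algebra_simps)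
    then show ?thesis
      using lam that by (auto dest: inj_onD)
  qed
  have inj: "inj_on v I"
  proof (rule inj_onI, rule ccontr)
    fix i j assume ij: "i \<in> I" "j \<in> I" "v i = v j" "i \<noteq> j"
    then have "v i \<bullet> v i = 0"
      using orth[of i j] by simp
    then show False
      using eig[of i] ij by simp
  qed
  have po: "pairwise orthogonal (v ` I)"
    using orth by (auto simp: pairwise_def orthogonal_def)
  have "0 \<notin> v ` I"
    using eig by force
  then have "independent (v ` I)"
    using po by (rule pairwise_orthogonal_independent[rotated])
  moreover have "card (v ` I) = DIM(real ^ 'n)"
    using I inj by (simp add: card_image)
  ultimately have "x \<in> span (v ` I)"
    using card_ge_dim_independent[of "v ` I" UNIV] by auto
  then have "(\<Sum>b\<in>v ` I. (b \<bullet> x) *\<^sub>R b) = x"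
    using orthonormal_basis_expand[OF po, of x] eig I(1)
    by (auto simp: inner_commute)
  then show ?thesis
    by (simp add: sum.reindex[OF inj] inner_commute)
qed

text \<open>The factor of \<open>g\<close> is the squared norm of the part of \<open>x\<close>
  orthogonal to \<open>v l\<close>. In eigenbasis coordinates the right-hand side weights each
  squared coordinate by \<open>lam i - lam l\<close>, which is 0 at \<open>l\<close> and at least
  \<open>g\<close> elsewhere.\<close>

lemma spectral_gap_inequality:
  fixes A :: "real ^ 'n ^ 'n" and v :: "'i \<Rightarrow> real ^ 'n"
  assumes sym: "transpose A = A"
    and I: "finite I" "card I = CARD('n)" and lam: "inj_on lam I"
    and eig: "\<And>i. i \<in> I \<Longrightarrow> norm (v i) = 1 \<and> A *v v i = lam i *\<^sub>R v i"
    and l: "l \<in> I" and gap: "\<And>i. i \<in> I \<Longrightarrow> i \<noteq> l \<Longrightarrow> lam l + g \<le> lam i"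
  shows "g * (x \<bullet> x - (x \<bullet> v l)\<^sup>2) \<le> x \<bullet> (A *v x) - lam l * (x \<bullet> x)"
proof -
  note expand = eigenbasis_expansion[OF sym I lam eig]
  have parseval: "x \<bullet> y = (\<Sum>i\<in>I. (x \<bullet> v i) * (y \<bullet> v i))" for y
  proof -
    have "x \<bullet> y = x \<bullet> (\<Sum>i\<in>I. (y \<bullet> v i) *\<^sub>R v i)"
      by (simp only: expand)
    also have "\<dots> = (\<Sum>i\<in>I. (x \<bullet> v i) * (y \<bullet> v i))"
      unfolding inner_sum_right by (simp add: mult.commute)
    finally show ?thesis .
  qed
  have Av: "(A *v x) \<bullet> v i = lam i * (x \<bullet> v i)" if "i \<in> I" for i
  proof -
    have "(A *v x) \<bullet> v i = x \<bullet> (A *v v i)"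
      by (metis inner_mult_vec sym)
    then show ?thesis
      using eig[OF that] by simp
  qed
  have "x \<bullet> (A *v x) - lam l * (x \<bullet> x) = (\<Sum>i\<in>I. (lam i - lam l) * (x \<bullet> v i)\<^sup>2)"
    by (simp add: parseval[of x] parseval[of "A *v x"] Av sum_distrib_left sum_subtractf[symmetric]
        right_diff_distrib power2_eq_square mult_ac)
  also have "\<dots> = (\<Sum>i\<in>I - {l}. (lam i - lam l) * (x \<bullet> v i)\<^sup>2)"
    using I l by (simp add: sum.remove)
  also have "\<dots> \<ge> (\<Sum>i\<in>I - {l}. g * (x \<bullet> v i)\<^sup>2)"
  proof (rule sum_mono)
    fix i assume "i \<in> I - {l}"
    then show "g * (x \<bullet> v i)\<^sup>2 \<le> (lam i - lam l) * (x \<bullet> v i)\<^sup>2"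
      using gap[of i] by (intro mult_right_mono) auto
  qed
  moreover have "(\<Sum>i\<in>I - {l}. g * (x \<bullet> v i)\<^sup>2) = g * (x \<bullet> x - (x \<bullet> v l)\<^sup>2)"
    using I l by (simp add: parseval[of x] sum.remove[of I l] sum_distrib_left power2_eq_square)
  ultimately show ?thesis
    by simp
qed

text \<open>The radius is fixed before \<open>u\<close> and \<open>s\<close>, so that one
  \<open>\<delta>\<close> serves all Newton sequences and all steps.\<close>

lemma shifted_form_pos_near_eigenvector:
  fixes A :: "real ^ 'n ^ 'n" and v :: "'i \<Rightarrow> real ^ 'n"
  assumes sym: "transpose A = A"
    and I: "finite I" "card I = CARD('n)" and lam: "inj_on lam I"
    and eig: "\<And>i. i \<in> I \<Longrightarrow> norm (v i) = 1 \<and> A *v v i = lam i *\<^sub>R v i"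
    and l: "l \<in> I" and gap: "\<And>i. i \<in> I \<Longrightarrow> i \<noteq> l \<Longrightarrow> lam l + g \<le> lam i" and g: "g > 0"
  obtains \<delta> where "\<delta> > 0"
    and "\<And>u s. norm (u - v l) < \<delta> \<Longrightarrow> orthogonal s u \<Longrightarrow> s \<noteq> 0 \<Longrightarrow>
      s \<bullet> (A *v s) - rayleigh A u * (s \<bullet> s) > 0"
proof -
  have "continuous (at (v l)) (rayleigh A)"
    unfolding rayleigh_def by (intro continuous_intros)
  moreover have "rayleigh A (v l) = lam l"
    using eig[OF l] by (simp add: rayleigh_def norm_eq_1)
  ultimately obtain d where d: "d > 0"
    and near: "\<And>u. dist u (v l) < d \<Longrightarrow> dist (rayleigh A u) (lam l) < g / 2"
    using g unfolding continuous_at_eps_delta by (metis half_gt_zero)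
  \<comment> \<open>Radius \<open>d\<close> keeps the Rayleigh quotient below
    \<open>lam l + g / 2\<close>; radius 1/2 leaves at least 3/4 of the squared norm of
    \<open>s\<close> orthogonal to \<open>v l\<close>. The gap then contributes
    \<open>3/4 * g\<close>, which exceeds the loss \<open>g / 2\<close>.\<close>
  show thesis
  proof (rule that[of "min d (1/2)"])
    show "min d (1/2) > 0"
      using d by simp
    fix u s :: "real ^ 'n"
    assume u: "norm (u - v l) < min d (1/2)" and s: "orthogonal s u" "s \<noteq> 0"
    have theta: "rayleigh A u < lam l + g / 2"
      using near[of u] u unfolding dist_norm real_norm_def by linarith
    \<comment> \<open>Orthogonality to \<open>u\<close> replaces \<open>v l\<close> by the short
      vector \<open>v l - u\<close>.\<close>
    have "s \<bullet> v l = - (s \<bullet> (u - v l))"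
      using s by (simp add: orthogonal_def inner_diff_right)
    then have "\<bar>s \<bullet> v l\<bar> \<le> norm s * norm (u - v l)"
      using Cauchy_Schwarz_ineq2[of s "u - v l"] by simp
    also have "\<dots> \<le> norm s * (1/2)"
      using u by (intro mult_left_mono) auto
    finally have "(s \<bullet> v l)\<^sup>2 \<le> (norm s * (1/2))\<^sup>2"
      by (rule power2_le_iff_abs_le[THEN iffD2, rotated]) simp
    then have "(s \<bullet> v l)\<^sup>2 \<le> (s \<bullet> s) / 4"
      by (simp add: power_mult_distrib power2_norm_eq_inner power_divide)
    then have "g * (3/4 * (s \<bullet> s)) \<le> g * (s \<bullet> s - (s \<bullet> v l)\<^sup>2)"
      using g by (intro mult_left_mono) auto
    also have "\<dots> \<le> s \<bullet> (A *v s) - lam l * (s \<bullet> s)"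
      by (rule spectral_gap_inequality[OF sym I lam eig l gap])
    finally have low: "g * (3/4 * (s \<bullet> s)) \<le> s \<bullet> (A *v s) - lam l * (s \<bullet> s)" .
    have ss: "s \<bullet> s > 0"
      using s by simp
    then have "rayleigh A u * (s \<bullet> s) < (lam l + g / 2) * (s \<bullet> s)"
      using theta by simp
    also have "\<dots> \<le> lam l * (s \<bullet> s) + g * (3/4 * (s \<bullet> s))"
      using g ss by (simp add: algebra_simps)
    finally show "s \<bullet> (A *v s) - rayleigh A u * (s \<bullet> s) > 0"
      using low by linarith
  qed
qed

section \<open>The correction equation and the preconditioner recursion\<close>

text \<open>Both projections in the Jacobian disappear when tested against \<open>s\<close>, which
  they fix. This turns positivity of the shifted form into the sign condition of
  \<open>spd_precond_update\<close>.\<close>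

lemma inner_correction_residual:
  assumes "orthogonal s u" and "jacobian A u *v s = - residual A u"
  shows "s \<bullet> residual A u = - (s \<bullet> (A *v s) - rayleigh A u * (s \<bullet> s))"
proof -
  have "orth_proj u *v s = s"
    using assms(1) by (simp add: orth_proj_mult_vec orthogonal_def inner_commute)
  then have "s \<bullet> (jacobian A u *v s) = s \<bullet> ((A - rayleigh A u *\<^sub>R mat 1) *v s)"
    by (simp add: jacobian_def matrix_vector_mul_assoc[symmetric] inner_mult_vec[of s "orth_proj u"]
        transpose_orth_proj)
  also have "\<dots> = s \<bullet> (A *v s) - rayleigh A u * (s \<bullet> s)"
    by (simp add: matrix_vector_mult_diff_rdistrib scaleR_mult_vec inner_diff_right)
  finally show ?thesis
    using assms(2) by simp
qed

theorem theorem3p2: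
  fixes A L :: "real ^ ('n :: {finite, linorder}) ^ ('n :: {finite, linorder})"
    and lam :: "nat \<Rightarrow> real"
    and v :: "nat \<Rightarrow> real ^ ('n :: {finite, linorder})"
    and r :: real
  assumes "spd A"
    and "strict_mono_on {1..CARD('n)} lam"
    and "\<And>i. i \<in> {1..CARD('n)} \<Longrightarrow> norm (v i) = 1 \<and> A *v v i = lam i *\<^sub>R v i"
    and "lower_triangular L"
    and "invertible L"
    and "r < 1"
  shows "\<exists>\<delta>>0. \<forall>u s.
           newton_iterates A u s \<longrightarrow>
           (\<forall>k. norm (u (Suc k) - v 1) < r * norm (u k - v 1)) \<longrightarrow>
           norm (u 0 - v 1) < \<delta> \<longrightarrow>
           (\<forall>k. let P = precond_seq (matrix_inv (L ** transpose L)) s (\<lambda>j. residual A (u j)) k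
                in s k \<bullet> residual A (u k) \<noteq> 0 \<and>
                   spd P \<and>
                   spd_on {x. orthogonal x (u k)} (orth_proj (u k) ** P ** orth_proj (u k)))"
proof -
  let ?I = "{1..CARD('n)}"
  have sym: "transpose A = A"
    using assms(1) by (simp add: spd_on_def)
  have inj: "inj_on lam ?I"
    using assms(2) by (rule strict_mono_on_imp_inj_on)
  have one: "1 \<in> ?I"
    by (simp add: Suc_le_eq)
  \<comment> \<open>In dimension 1 there is no second eigenvalue and any positive gap will do.\<close>
  define g where "g = (if CARD('n) = 1 then 1 else lam 2 - lam 1)"
  have g: "g > 0"
  proof (cases "CARD('n) = 1")
    case False
    then have "2 \<in> ?I"
      using one unfolding atLeastAtMost_iff by linarith
    then show ?thesis
      using strict_mono_onD[OF assms(2) one, of 2] False by (simp add: g_def)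
  qed (simp add: g_def)
  have gap: "lam 1 + g \<le> lam i" if "i \<in> ?I" "i \<noteq> 1" for i
  proof -
    have "2 \<in> ?I" "2 \<le> i" "CARD('n) \<noteq> 1"
      using that by auto
    then show ?thesis
      using strict_mono_on_leD[OF assms(2), of 2 i] that(1) by (simp add: g_def)
  qed
  obtain \<delta> where \<delta>: "\<delta> > 0"
    and pos: "\<And>u s. norm (u - v 1) < \<delta> \<Longrightarrow> orthogonal s u \<Longrightarrow> s \<noteq> 0 \<Longrightarrow>
      s \<bullet> (A *v s) - rayleigh A u * (s \<bullet> s) > 0"
    using shifted_form_pos_near_eigenvector[OF sym _ _ inj assms(3) one gap g] by auto
  have "s k \<bullet> residual A (u k) \<noteq> 0 \<and>
      spd (precond_seq (matrix_inv (L ** transpose L)) s (\<lambda>j. residual A (u j)) k)"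
    if nit: "newton_iterates A u s"
      and contr: "\<forall>k. norm (u (Suc k) - v 1) < r * norm (u k - v 1)"
      and start: "norm (u 0 - v 1) < \<delta>" for u s k
  proof -
    \<comment> \<open>The contraction keeps every iterate inside the ball where \<open>pos\<close>
      applies.\<close>
    have close: "norm (u k - v 1) < \<delta>" for k
    proof (induction k)
      case 0
      show ?case by (rule start)
    next
      case (Suc k)
      have "r * norm (u k - v 1) \<le> norm (u k - v 1)"
        using assms(6) mult_right_mono[of r 1 "norm (u k - v 1)"] by simp
      then show ?case
        using contr Suc by (smt (verit))
    qed
    have neg: "s k \<bullet> residual A (u k) < 0" for k
      using nit pos[OF close, of "s k" k] inner_correction_residual[of "s k" "u k" A]
      by (simp add: newton_iterates_def)
    \<comment> \<open>The Cholesky-type product starts the induction, and the sign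
      \<open>neg\<close> carries each update.\<close>
    have "spd (precond_seq (matrix_inv (L ** transpose L)) s (\<lambda>j. residual A (u j)) k)"
      by (induction k) (simp_all add: spd_matrix_inv_mult_transpose assms(5) spd_precond_update neg)
    then show ?thesis
      using neg[of k] by simp
  qed
  then show ?thesis
    using \<delta> unfolding Let_def by (blast intro: spd_on_orth_proj)
qed

end
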